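(* Let $(X,d)$ be a metric space, let $T:X\to X$ be a self-mapping, let $\varphi:X\to[0,\infty)$ be a given function, and let $\rho:=\inf\{d(Tx,x): x\in X,\ x\neq Tx\}$. Let $x_0\in X$ and suppose that $T$ is a type $3$ $\varphi_{x_0}$-contraction with the point $x_0$ and the function $\varphi$. If $\varphi(x_0)=0$ and $\varphi(x)\leq d(Tx,x)$ for all $x\in C_{x_0,\rho}$, then the circle $C_{x_0,\rho}$ is a $\varphi$-fixed circle of $T$.
   Context: Notation: $Fix(T)=\{x\in X: Tx=x\}$, $Z_\varphi=\{x\in X:\varphi(x)=0\}$, and $C_{x_0,r}=\{x\in X: d(x,x_0)=r\}$. A circle $C_{x_0,r}$ is a $\varphi$-fixed circle of $T$ if and only if $C_{x_0,r}\subseteq Fix(T)\cap Z_\varphi$. $T$ is a type $3$ $\varphi_{x_0}$-contraction if there is some $k\in(0,1)$ such that, for all $x\in X$, $d(Tx,x)>0$ implies $d(x,Tx)+\varphi(Tx)+\varphi(x)\leq k\left[d(x,x_0)+\varphi(x)+\varphi(x_0)\right]$. *)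

theory Defs
  imports "HOL-Analysis.Analysis"
begin

definition Fix :: "('a \<Rightarrow> 'a) \<Rightarrow> 'a set" where
  "Fix T = {x. T x = x}"

definition zero_set :: "('a \<Rightarrow> real) \<Rightarrow> 'a set" where
  "zero_set \<phi> = {x. \<phi> x = 0}"

text \<open>The circle with centre \<open>x0\<close> and radius \<open>r\<close> is the library's \<^const>\<open>sphere\<close>; the radius may be 0.\<close>

definition phi_fixed_circle ::
    "('a::metric_space \<Rightarrow> 'a) \<Rightarrow> ('a \<Rightarrow> real) \<Rightarrow> 'a \<Rightarrow> real \<Rightarrow> bool" where
  "phi_fixed_circle T \<phi> x0 r \<longleftrightarrow> sphere x0 r \<subseteq> Fix T \<inter> zero_set \<phi>"

definition type3_phi_contraction ::
    "('a::metric_space \<Rightarrow> 'a) \<Rightarrow> ('a \<Rightarrow> real) \<Rightarrow> 'a \<Rightarrow> bool" where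
  "type3_phi_contraction T \<phi> x0 \<longleftrightarrow>
    (\<exists>k. 0 < k \<and> k < 1 \<and>
      (\<forall>x. dist (T x) x > 0 \<longrightarrow>
        dist x (T x) + \<phi> (T x) + \<phi> x \<le> k * (dist x x0 + \<phi> x + \<phi> x0)))"

text \<open>If \<open>T\<close> is the identity, the set below is empty and its real infimum is an unspecified
  real number, where the usual convention would give an infinite radius and hence an empty circle.\<close>

definition rho :: "('a::metric_space \<Rightarrow> 'a) \<Rightarrow> real" where
  "rho T = Inf {dist (T x) x | x. x \<noteq> T x}"

end

theory Submission
  imports Defs
begin

text \<open>A moved point \<open>x\<close> is displaced by at least \<open>rho T\<close>
  (\<open>rho_le_dist\<close>). If it lies on the circle, its distance to \<open>x0\<close> is
  therefore at most its displacement; as \<phi> vanishes at \<open>x0\<close>, the contraction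
  bounds displacement plus \<open>\<phi> x\<close> by \<open>k < 1\<close> times itself, which is
  absurd. So circle points are fixed, and there the bound of \<phi> by the displacement forces
  \<phi> to be 0. The infimum is used only once some point moves, so its unspecified value for the
  identity does no harm.\<close>

lemma rho_le_dist:
  assumes "T x \<noteq> x"
  shows "rho T \<le> dist (T x) x"
  unfolding rho_def
proof (rule cInf_lower)
  show "dist (T x) x \<in> {dist (T x) x |x. x \<noteq> T x}"
    using assms by force
  show "bdd_below {dist (T x) x |x. x \<noteq> T x}"
    by (rule bdd_belowI[of _ 0]) auto
qed

theorem theorem2p9:
  fixes T :: "'a::metric_space \<Rightarrow> 'a" and \<phi> :: "'a \<Rightarrow> real" and x0 :: 'a
  assumes "\<And>x. \<phi> x \<ge> 0"
    and "type3_phi_contraction T \<phi> x0"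
    and "\<phi> x0 = 0"
    and "\<And>x. x \<in> sphere x0 (rho T) \<Longrightarrow> \<phi> x \<le> dist (T x) x"
  shows "phi_fixed_circle T \<phi> x0 (rho T)"
proof -
  obtain k where k: "0 < k" "k < 1"
    and contr: "\<And>x. dist (T x) x > 0 \<Longrightarrow>
      dist x (T x) + \<phi> (T x) + \<phi> x \<le> k * (dist x x0 + \<phi> x + \<phi> x0)"
    using assms(2) unfolding type3_phi_contraction_def by blast
  have "T x = x \<and> \<phi> x = 0" if x: "x \<in> sphere x0 (rho T)" for x
  proof -
    have "T x = x"
    proof (rule ccontr)
      assume neq: "T x \<noteq> x"
      \<comment> \<open>This quantity separates the two sides of the contraction: dropping
        \<open>\<phi> (T x)\<close> leaves it on the left, and it dominates the bracket on the
        right.\<close>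
      define s where "s = dist x (T x) + \<phi> x"
      have "s > 0"
        unfolding s_def using neq assms(1)[of x] by (simp add: add_pos_nonneg)
      have "s \<le> dist x (T x) + \<phi> (T x) + \<phi> x"
        unfolding s_def using assms(1)[of "T x"] by simp
      also have "\<dots> \<le> k * (dist x x0 + \<phi> x + \<phi> x0)"
        using contr neq by simp
      \<comment> \<open>On the circle \<open>dist x x0\<close> equals \<open>rho T\<close>, hence is
        at most \<open>dist (T x) x\<close>; the term \<open>\<phi> x0\<close> is 0.\<close>
      also have "\<dots> \<le> k * s"
        unfolding s_def using rho_le_dist[of T x] neq x k assms(3)
        by (intro mult_left_mono) (auto simp: dist_commute)
      also have "\<dots> < s"
        using \<open>s > 0\<close> k by simp
      finally show False by simp
    qed
    \<comment> \<open>At a fixed point the displacement is 0, so \<phi> is squeezed between 0 and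
      0.\<close>
    moreover have "\<phi> x = 0"
      using assms(4)[OF x] assms(1)[of x] \<open>T x = x\<close> by simp
    ultimately show ?thesis by blast
  qed
  then show ?thesis
    unfolding phi_fixed_circle_def Fix_def zero_set_def by blast
qed

end
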